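(* Let $(\mathsf{T},\mathsf{F})$ be a tree with dynamics such that $H\ge 1$. Let $(\mathsf{x}_{l(k)})_{k\in\mathbb{Z}}$ be a return chain of an extended end of $\mathsf{T}$, with return times $(n_k)_{k\in\mathbb{Z}}$. Then $(n_k)_{k\in\mathbb{Z}}$ are (extended) variable-$r$ meta-Fibonacci numbers; that is, there is a function $r:\mathbb{Z}\to\mathbb{Z}^+$ such that $n_k=\sum_{j=1}^{r(k)}n_{k-j}$ for all $k\in\mathbb{Z}$.
   Context: A genealogical tree is a tree $\mathsf{T}$ (a non-empty countable connected graph with every circuit trivial; $\mathsf{T}$ also denotes its vertex set) in which each vertex $\mathsf{v}$ is associated with a unique adjacent vertex $\mathsf{v}^{\mathsf p}$, its parent; every other vertex adjacent to $\mathsf{v}$ is a child of $\mathsf{v}$, and $\mathsf{w}$ is a child of $\mathsf{v}$ if and only if $\mathsf{w}^{\mathsf p}=\mathsf{v}$. A vertex $\mathsf{v}$ is an ancestor of $\mathsf{v}'$ (and $\mathsf{v}'$ a descendant of $\mathsf{v}$) if there are vertices $\mathsf{v}=\mathsf{v}_0,\dots,\mathsf{v}_n=\mathsf{v}'$ with $\mathsf{v}_{i-1}=\mathsf{v}_i^{\mathsf p}$; any two vertices have a common ancestor, and $\mathsf{v}^{\mathsf p}$ is never a descendant of $\mathsf{v}$. Consequently $\mathsf{T}=\bigcup_{l\in\mathbb{Z}}\mathsf{T}_l$ is partitioned into levels with $\mathsf{T}_l=\{\mathsf{v}:\mathsf{v}^{\mathsf p}\in\mathsf{T}_{l-1}\}$,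 unique up to a shift of index; such an indexing is fixed. A map $\mathsf{F}:\mathsf{T}\to\mathsf{T}$ preserves children if the image of each child of $\mathsf{v}$ is a child of $\mathsf{F}(\mathsf{v})$, for every $\mathsf{v}$. A tree with dynamics is a pair $(\mathsf{T},\mathsf{F})$ with $\mathsf{T}$ a genealogical tree and $\mathsf{F}:\mathsf{T}\to\mathsf{T}$ preserving children. Then there is $H\in\mathbb{Z}$ such that $\mathsf{F}(\mathsf{T}_l)\subset\mathsf{T}_{l-H}$ for all $l\in\mathbb{Z}$; $H$ always denotes this integer. An extended end is a sequence $\boldsymbol{\mathsf{x}}=(\mathsf{x}_l)_{l\in\mathbb{Z}}$ with $\mathsf{x}_l\in\mathsf{T}_l$ and $\mathsf{x}_{l-1}=\mathsf{x}_l^{\mathsf p}$ for all $l$. For $n\ge1$, $\mathsf{F}^n(\mathsf{x}_L)$ returns (to $\boldsymbol{\mathsf{x}}$) if $\mathsf{F}^n(\mathsf{x}_L)=\mathsf{x}_m$ for some $m\in\mathbb{Z}$. If $n\ge1$ is minimal such that $\mathsf{F}^n(\mathsf{x}_L)$ returns, then $n$ is the first return time of $\mathsf{x}_L$ and $\mathsf{F}^n(\mathsf{x}_L)$ is its first return. A return chain of $\boldsymbol{\mathsf{x}}$ is a sub-end $(\mathsf{x}_{l(k)})_{k\in\mathbb{Z}}$ such that $\mathsf{F}^{n_k}(\mathsf{x}_{l(k)})=\mathsf{x}_{l(k-1)}$ for all $k\in\mathbb{Z}$, where $n_k$ is the first return time of $\mathsf{x}_{l(k)}$; $(n_k)_{k\in\mathbb{Z}}$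 are its return times. *)

theory Defs
  imports Main "HOL-Library.Countable_Set" "HOL-Library.Disjoint_Sets"
begin

definition walk :: "'a set \<Rightarrow> ('a \<Rightarrow> 'a \<Rightarrow> bool) \<Rightarrow> 'a list \<Rightarrow> bool" where
  "walk V E vs \<longleftrightarrow> vs \<noteq> [] \<and> set vs \<subseteq> V \<and> successively E vs"

text \<open>A circuit is a closed walk that uses no edge twice, where an edge is the unordered pair of
  its endpoints. The circuit is trivial if it consists of a single vertex.\<close>

definition circuit :: "'a set \<Rightarrow> ('a \<Rightarrow> 'a \<Rightarrow> bool) \<Rightarrow> 'a list \<Rightarrow> bool" where
  "circuit V E vs \<longleftrightarrow> walk V E vs \<and> hd vs = last vs \<and>
     distinct (map (\<lambda>(u, v). {u, v}) (zip vs (tl vs)))"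

locale simple_graph =
  fixes V :: "'a set" and E :: "'a \<Rightarrow> 'a \<Rightarrow> bool"
  assumes edge_vertices: "E u v \<Longrightarrow> u \<in> V \<and> v \<in> V"
    and edge_sym: "E u v \<Longrightarrow> E v u"
    and edge_irrefl: "\<not> E v v"

locale countable_tree = simple_graph V E
  for V :: "'a set" and E :: "'a \<Rightarrow> 'a \<Rightarrow> bool" +
  assumes nonempty: "V \<noteq> {}"
    and countable: "countable V"
    and connected: "u \<in> V \<Longrightarrow> v \<in> V \<Longrightarrow> \<exists>vs. walk V E vs \<and> hd vs = u \<and> last vs = v"
    and circuit_trivial: "circuit V E vs \<Longrightarrow> length vs = 1"

text \<open>In the following, \<open>p v\<close> is the parent of \<open>v\<close>.\<close>

definition is_child :: "('a \<Rightarrow> 'a \<Rightarrow> bool) \<Rightarrow> ('a \<Rightarrow> 'a) \<Rightarrow> 'a \<Rightarrow> 'a \<Rightarrow> bool" where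
  "is_child E p w v \<longleftrightarrow> E v w \<and> w \<noteq> p v"

text \<open>The chain may have length \<open>n = 0\<close>, so every vertex is an ancestor of itself.\<close>

definition is_ancestor :: "'a set \<Rightarrow> ('a \<Rightarrow> 'a) \<Rightarrow> 'a \<Rightarrow> 'a \<Rightarrow> bool" where
  "is_ancestor V p v v' \<longleftrightarrow> (\<exists>(n::nat) u. (\<forall>i\<le>n. u i \<in> V) \<and> u 0 = v \<and> u n = v' \<and>
     (\<forall>i\<in>{1..n}. u (i - 1) = p (u i)))"

locale genealogical_tree = countable_tree V E
  for V :: "'a set" and E :: "'a \<Rightarrow> 'a \<Rightarrow> bool" +
  fixes p :: "'a \<Rightarrow> 'a"
  assumes parent_adjacent: "v \<in> V \<Longrightarrow> E v (p v)"
    and child_iff_parent: "v \<in> V \<Longrightarrow> w \<in> V \<Longrightarrow> is_child E p w v \<longleftrightarrow> p w = v"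
    and common_ancestor:
      "v \<in> V \<Longrightarrow> w \<in> V \<Longrightarrow> \<exists>u\<in>V. is_ancestor V p u v \<and> is_ancestor V p u w"
    and parent_not_descendant: "v \<in> V \<Longrightarrow> \<not> is_ancestor V p v (p v)"

text \<open>Levels may be empty: a genealogical tree need not be unbounded in the direction of the
  children.\<close>

definition level_indexing :: "'a set \<Rightarrow> ('a \<Rightarrow> 'a) \<Rightarrow> (int \<Rightarrow> 'a set) \<Rightarrow> bool" where
  "level_indexing V p T \<longleftrightarrow> V = (\<Union>l. T l) \<and> disjoint_family T \<and>
     (\<forall>l. T l = {v \<in> V. p v \<in> T (l - 1)})"

locale tree_with_dynamics = genealogical_tree V E p
  for V :: "'a set" and E :: "'a \<Rightarrow> 'a \<Rightarrow> bool" and p :: "'a \<Rightarrow> 'a" +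
  fixes F :: "'a \<Rightarrow> 'a"
  assumes maps_to: "v \<in> V \<Longrightarrow> F v \<in> V"
    and preserves_children: "v \<in> V \<Longrightarrow> is_child E p w v \<Longrightarrow> is_child E p (F w) (F v)"

definition extended_end :: "('a \<Rightarrow> 'a) \<Rightarrow> (int \<Rightarrow> 'a set) \<Rightarrow> (int \<Rightarrow> 'a) \<Rightarrow> bool" where
  "extended_end p T x \<longleftrightarrow> (\<forall>l. x l \<in> T l \<and> x (l - 1) = p (x l))"

definition returns :: "('a \<Rightarrow> 'a) \<Rightarrow> (int \<Rightarrow> 'a) \<Rightarrow> int \<Rightarrow> nat \<Rightarrow> bool" where
  "returns F x L n \<longleftrightarrow> (\<exists>m. (F ^^ n) (x L) = x m)"

definition first_return_time :: "('a \<Rightarrow> 'a) \<Rightarrow> (int \<Rightarrow> 'a) \<Rightarrow> int \<Rightarrow> nat \<Rightarrow> bool" where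
  "first_return_time F x L n \<longleftrightarrow>
     n \<ge> 1 \<and> returns F x L n \<and> (\<forall>n'\<ge>1. returns F x L n' \<longrightarrow> n \<le> n')"

text \<open>The sub-end \<open>k \<mapsto> x (l k)\<close> is a return chain of \<open>x\<close> with return times \<open>n\<close>. That it is a
  sub-end means that \<open>l\<close> is strictly increasing.\<close>

definition return_chain ::
  "('a \<Rightarrow> 'a) \<Rightarrow> (int \<Rightarrow> 'a) \<Rightarrow> (int \<Rightarrow> int) \<Rightarrow> (int \<Rightarrow> nat) \<Rightarrow> bool" where
  "return_chain F x l n \<longleftrightarrow> strict_mono l \<and>
     (\<forall>k. first_return_time F x (l k) (n k) \<and> (F ^^ n k) (x (l k)) = x (l (k - 1)))"

definition variable_r_meta_fibonacci :: "(int \<Rightarrow> nat) \<Rightarrow> bool" where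
  "variable_r_meta_fibonacci n \<longleftrightarrow>
     (\<exists>r :: int \<Rightarrow> int. (\<forall>k. r k > 0) \<and> (\<forall>k. n k = (\<Sum>j = 1..r k. n (k - j))))"

end

(* Since F commutes with taking parents, a return of x_L after n steps forces a return after n steps
   of every x_M with M <= L. In particular n_k is a return time of x_{l(k-1)}. Following the orbit of
   x_{l(k-1)} along the chain, its return times are exactly the partial sums
   n_{k-1} + ... + n_{k-r}, so n_k is one of them. *)
theory Submission
  imports Defs
begin

text \<open>\<open>v\<close> is a child of \<open>p v\<close>, so preservation of children makes
  \<open>F v\<close> a child of \<open>F (p v)\<close>, which identifies the parent of
  \<open>F v\<close>.\<close>

lemma (in tree_with_dynamics) F_parent:
  assumes "v \<in> V"
  shows "F (p v) = p (F v)"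
proof -
  have "p v \<in> V"
    using parent_adjacent[OF assms] edge_vertices by blast
  moreover from this have "is_child E p v (p v)"
    using child_iff_parent assms by blast
  ultimately have "is_child E p (F v) (F (p v))"
    using preserves_children by blast
  then show ?thesis
    using child_iff_parent maps_to \<open>p v \<in> V\<close> assms by metis
qed

lemma (in tree_with_dynamics) funpow_F_parent:
  assumes "v \<in> V"
  shows "(F ^^ n) v \<in> V" and "(F ^^ n) (p v) = p ((F ^^ n) v)"
  using assms by (induction n) (auto simp: maps_to F_parent)

text \<open>Descend from \<open>L\<close> one level at a time: taking parents in
  \<open>(F ^^ n) (x i) = x m\<close> gives \<open>(F ^^ n) (x (i - 1)) = x (m - 1)\<close>.\<close>

lemma (in tree_with_dynamics) returns_antimono:
  assumes V: "\<And>l. x l \<in> V" and parent: "\<And>l. x (l - 1) = p (x l)"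
    and "M \<le> L" and "returns F x L n"
  shows "returns F x M n"
  using \<open>M \<le> L\<close>
proof (induction M rule: int_le_induct)
  case base
  show ?case by fact
next
  case (step i)
  then obtain m where "(F ^^ n) (x i) = x m"
    by (auto simp: returns_def)
  then have "(F ^^ n) (x (i - 1)) = x (m - 1)"
    using funpow_F_parent(2)[OF V] by (simp add: parent)
  then show ?case
    by (auto simp: returns_def)
qed

text \<open>Minimality gives \<open>n k \<le> m\<close>. After \<open>n k\<close> steps the orbit is
  at \<open>x (l (k - 1))\<close>, so the remaining \<open>m - n k\<close> steps are either none or
  again a return time, now of a later link of the chain. Strong induction on \<open>m\<close> peels
  off the summands one by one.\<close>

lemma return_time_partial_sum:
  assumes "return_chain F x l n" and "m \<ge> 1" and "returns F x (l k) m"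
  shows "\<exists>r::int > 0. m = (\<Sum>j = 1..r. n (k + 1 - j))"
  using assms(2,3)
proof (induction m arbitrary: k rule: less_induct)
  case (less m)
  have pos: "n k \<ge> 1" and le: "n k \<le> m" and step: "(F ^^ n k) (x (l k)) = x (l (k - 1))"
    using assms(1) less.prems by (auto simp: return_chain_def first_return_time_def)
  show ?case
  proof (cases "m = n k")
    case True
    then show ?thesis by (intro exI[of _ 1]) simp
  next
    case False
    \<comment> \<open>The summand \<open>n k\<close> stands on the right so that
      \<open>funpow_add\<close> applies these steps first.\<close>
    have "(F ^^ m) (x (l k)) = (F ^^ (m - n k + n k)) (x (l k))"
      using le by simp
    also have "\<dots> = (F ^^ (m - n k)) (x (l (k - 1)))"
      unfolding funpow_add by (simp add: step)
    finally have "returns F x (l (k - 1)) (m - n k)"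
      using less.prems(2) by (simp add: returns_def)
    moreover have "m - n k < m" and "m - n k \<ge> 1"
      using pos le False by auto
    ultimately obtain r :: int where r: "r > 0" "m - n k = (\<Sum>j = 1..r. n (k - j))"
      using less.IH[of "m - n k" "k - 1"] by auto
    \<comment> \<open>The term at \<open>j = 1\<close> is \<open>n k\<close>; shifting
      \<open>j\<close> by one turns the others into the sum for \<open>m - n k\<close>.\<close>
    have "{1..r + 1} = insert 1 {2..r + 1}"
      using r(1) by auto
    then have "(\<Sum>j = 1..r + 1. n (k + 1 - j)) = n k + (\<Sum>j = 2..r + 1. n (k + 1 - j))"
      by simp
    also have "(\<Sum>j = 2..r + 1. n (k + 1 - j)) = (\<Sum>j = 1..r. n (k - j))"
      by (rule sum.reindex_bij_witness[where i = "\<lambda>j. j + 1" and j = "\<lambda>j. j - 1"])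
        (auto simp: algebra_simps)
    finally show ?thesis
      using r le by (intro exI[of _ "r + 1"]) simp
  qed
qed

theorem theorem2p11:
  fixes V :: "'a set" and E :: "'a \<Rightarrow> 'a \<Rightarrow> bool" and p F :: "'a \<Rightarrow> 'a"
    and T :: "int \<Rightarrow> 'a set" and H :: int
    and x :: "int \<Rightarrow> 'a" and l :: "int \<Rightarrow> int" and n :: "int \<Rightarrow> nat"
  assumes "tree_with_dynamics V E p F"
    and "level_indexing V p T"
    and "\<forall>m. F ` T m \<subseteq> T (m - H)"
    and "H \<ge> 1"
    and "extended_end p T x"
    and "return_chain F x l n"
  shows "variable_r_meta_fibonacci n"
proof -
  interpret tree_with_dynamics V E p F by fact
  have V: "x i \<in> V" and parent: "x (i - 1) = p (x i)" for i
    using assms(2,5) unfolding level_indexing_def extended_end_def by blast+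
  have "\<exists>r::int > 0. n k = (\<Sum>j = 1..r. n (k - j))" for k
  proof -
    have "n k \<ge> 1" and "returns F x (l k) (n k)" and "l (k - 1) \<le> l k"
      using assms(6)
      by (auto simp: return_chain_def first_return_time_def strict_mono_less_eq)
    moreover from this have "returns F x (l (k - 1)) (n k)"
      using returns_antimono[of x, OF V parent] by blast
    \<comment> \<open>Starting at \<open>k - 1\<close> turns the index \<open>k + 1 - j\<close> of
      the lemma into \<open>k - j\<close>.\<close>
    ultimately show ?thesis
      using return_time_partial_sum[OF assms(6), of "n k" "k - 1"] by simp
  qed
  then show ?thesis
    unfolding variable_r_meta_fibonacci_def by metis
qed

end
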